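(* Let $P_n(z)$, $n\ge0$, be the Pastro polynomials with parameters $a,b$. Define the q-difference operators $$L_1=\frac{b^2z-q}{(q-1)z}\,T^{+}+\frac{q-bz}{(q-1)z}\,\mathcal{I},\qquad L_2=\frac{aq-b^2z}{bz}\,T^{-}+\frac{b^3z-aq}{bz}\,\mathcal{I}.$$ Then $L_1$ and $L_2$ are little q-Heun operators, and for every $n\ge0$ the polynomial $P_n$ satisfies the generalized eigenvalue problem $$L_1P_n(z)=\lambda_nL_2P_n(z),\qquad \lambda_n=\frac{q^n}{q-1};$$ equivalently, $P_n$ lies in the kernel of the linear pencil: $(L_1-\lambda_nL_2)P_n(z)=0$.
   Context: $q\in\mathbb{C}$ is nonzero and not a root of unity; $T^{+}f(z)=f(qz)$, $T^{-}f(z)=f(z/q)$, and $\mathcal{I}$ is the identity operator. With $(y;q)_k=\prod_{j=0}^{k-1}(1-yq^j)$, the Pastro polynomials with parameters $a,b$ are $$P_n(z)=\kappa_n\,{}_2\Phi_1\left({q^{-n},\,b\atop \frac{b}{a}q^{1-n}};q,\frac{zb^2}{a}\right)=\kappa_n\sum_{k=0}^n\frac{(q^{-n};q)_k(b;q)_k}{(\frac{b}{a}q^{1-n};q)_k(q;q)_k}\left(\frac{zb^2}{a}\right)^k,$$ where the constant $\kappa_n$ is chosen so that $P_n(z)=z^n+O(z^{n-1})$ is monic. The parameters $a,b\in\mathbb{C}$ are nonzero and such that the $P_n$ are well defined, i.e. $bq^{k}\neq1$ and $aq^{k}\ne b$ for all integers $k\ge0$. A little q-Heun operator (in the variable $z$)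 is an operator $A_1(z)T^{+}+A_2(z)T^{-}+A_0(z)\mathcal{I}$ with $A_1=r_2(z)/z$, $A_2=(q\,r_2(z)+p_2(z))/z$, $A_0=-A_1-A_2+p_1(z)$, where $r_2,p_2$ are polynomials of degree at most $2$ and $p_1$ is a polynomial of degree at most $1$. *)

theory Defs
  imports Complex_Main "HOL-Computational_Algebra.Polynomial"
begin

definition q_pochhammer :: "complex \<Rightarrow> complex \<Rightarrow> nat \<Rightarrow> complex" where
  "q_pochhammer y q k = (\<Prod>j<k. 1 - y * q ^ j)"

definition pastro_coeff :: "complex \<Rightarrow> complex \<Rightarrow> complex \<Rightarrow> nat \<Rightarrow> nat \<Rightarrow> complex" where
  "pastro_coeff q a b n k =
     q_pochhammer (q powi (- int n)) q k * q_pochhammer b q k /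
     (q_pochhammer (b / a * q powi (1 - int n)) q k * q_pochhammer q q k) * (b\<^sup>2 / a) ^ k"

text \<open>The sum is cut off at \<open>n\<close> explicitly: beyond it, the factor
  \<open>(b / a * q powi (1 - n); q)\<^sub>k\<close> in the denominator may vanish.\<close>

definition pastro_2phi1 :: "complex \<Rightarrow> complex \<Rightarrow> complex \<Rightarrow> nat \<Rightarrow> complex poly" where
  "pastro_2phi1 q a b n = (\<Sum>k\<le>n. monom (pastro_coeff q a b n k) k)"

definition pastro_kappa :: "complex \<Rightarrow> complex \<Rightarrow> complex \<Rightarrow> nat \<Rightarrow> complex" where
  "pastro_kappa q a b n = inverse (coeff (pastro_2phi1 q a b n) n)"

definition pastro :: "complex \<Rightarrow> complex \<Rightarrow> complex \<Rightarrow> nat \<Rightarrow> complex poly" where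
  "pastro q a b n = smult (pastro_kappa q a b n) (pastro_2phi1 q a b n)"

lemma coeff_pastro_2phi1:
  "coeff (pastro_2phi1 q a b n) k = (if k \<le> n then pastro_coeff q a b n k else 0)"
  by (simp add: pastro_2phi1_def coeff_sum)

lemma pastro_denominator_nonzero:
  assumes "q \<noteq> 0" "\<And>m::nat. m > 0 \<Longrightarrow> q ^ m \<noteq> 1" "a \<noteq> 0" "\<And>k::nat. a * q ^ k \<noteq> b" "k \<le> n"
  shows "q_pochhammer (b / a * q powi (1 - int n)) q k * q_pochhammer q q k \<noteq> 0"
proof -
  have "1 - b / a * q powi (1 - int n) * q ^ j \<noteq> 0" if "j < k" for j
  proof
    assume A: "1 - b / a * q powi (1 - int n) * q ^ j = 0"
    have "q powi (1 - int n) * q ^ j * q ^ (n - 1 - j) = q powi (1 - int n + int j + int (n - 1 - j))"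
      using assms(1) by (simp add: power_int_add)
    also have "1 - int n + int j + int (n - 1 - j) = 0"
      using that assms(5) by simp
    finally have B: "q powi (1 - int n) * q ^ j * q ^ (n - 1 - j) = 1" by simp
    from A have "a = b * (q powi (1 - int n) * q ^ j)"
      using assms(3) by (simp add: field_simps)
    hence "a * q ^ (n - 1 - j) = b * (q powi (1 - int n) * q ^ j * q ^ (n - 1 - j))"
      by (simp add: mult.assoc)
    with B assms(4) show False by simp
  qed
  moreover have "1 - q * q ^ j \<noteq> 0" for j
    using assms(2)[of "Suc j"] by auto
  ultimately show ?thesis using assms(3) by (auto simp: q_pochhammer_def)
qed

lemma pastro_monic:
  assumes "q \<noteq> 0" "\<And>m::nat. m > 0 \<Longrightarrow> q ^ m \<noteq> 1" "a \<noteq> 0" "b \<noteq> 0"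
    and "\<And>k::nat. b * q ^ k \<noteq> 1" "\<And>k::nat. a * q ^ k \<noteq> b"
  shows "degree (pastro q a b n) = n" "lead_coeff (pastro q a b n) = 1"
proof -
  have "1 - q powi (- int n) * q ^ j \<noteq> 0" if "j < n" for j
  proof
    assume A: "1 - q powi (- int n) * q ^ j = 0"
    have "q ^ n = q ^ (n - j) * q ^ j"
      using that by (simp flip: power_add)
    moreover have "q ^ n = q ^ j"
      using A assms(1) by (simp add: power_int_minus field_simps)
    ultimately have "q ^ (n - j) = 1" using assms(1) by simp
    with assms(2)[of "n - j"] that show False by simp
  qed
  moreover have "1 - b * q ^ j \<noteq> 0" for j
    using assms(5)[of j] by auto
  ultimately have nz: "pastro_coeff q a b n n \<noteq> 0"
    using pastro_denominator_nonzero[OF assms(1-3,6) order_refl, of n] assms(3,4)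
    by (simp add: pastro_coeff_def q_pochhammer_def)
  have one: "coeff (pastro q a b n) n = 1"
    using nz by (simp add: pastro_def pastro_kappa_def coeff_pastro_2phi1)
  have "degree (pastro q a b n) \<le> n"
    by (rule degree_le) (simp add: pastro_def coeff_pastro_2phi1)
  with one show "degree (pastro q a b n) = n"
    by (metis le_antisym le_degree zero_neq_one)
  with one show "lead_coeff (pastro q a b n) = 1" by simp
qed

text \<open>The operators below have coefficients with a pole at \<open>0\<close>. They act on functions on the
  punctured plane \<open>z \<noteq> 0\<close>, which is invariant under \<open>z \<mapsto> q * z\<close> and \<open>z \<mapsto> z / q\<close>; values at
  \<open>z = 0\<close> are meaningless and every identity is asserted for \<open>z \<noteq> 0\<close> only.\<close>

type_synonym operator = "(complex \<Rightarrow> complex) \<Rightarrow> (complex \<Rightarrow> complex)"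

definition T_plus :: "complex \<Rightarrow> operator" where
  "T_plus q f = (\<lambda>z. f (q * z))"

definition T_minus :: "complex \<Rightarrow> operator" where
  "T_minus q f = (\<lambda>z. f (z / q))"

definition q_difference_operator ::
  "complex \<Rightarrow> (complex \<Rightarrow> complex) \<Rightarrow> (complex \<Rightarrow> complex) \<Rightarrow> (complex \<Rightarrow> complex) \<Rightarrow> operator" where
  "q_difference_operator q A1 A2 A0 f =
     (\<lambda>z. A1 z * T_plus q f z + A2 z * T_minus q f z + A0 z * f z)"

definition operator_eq :: "operator \<Rightarrow> operator \<Rightarrow> bool" where
  "operator_eq L M \<longleftrightarrow> (\<forall>f. \<forall>z. z \<noteq> 0 \<longrightarrow> L f z = M f z)"

definition little_q_Heun :: "complex \<Rightarrow> operator \<Rightarrow> bool" where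
  "little_q_Heun q L \<longleftrightarrow>
     (\<exists>r2 p2 p1 :: complex poly. degree r2 \<le> 2 \<and> degree p2 \<le> 2 \<and> degree p1 \<le> 1 \<and>
        (let A1 = (\<lambda>z. poly r2 z / z);
             A2 = (\<lambda>z. (q * poly r2 z + poly p2 z) / z);
             A0 = (\<lambda>z. - A1 z - A2 z + poly p1 z)
         in operator_eq L (q_difference_operator q A1 A2 A0)))"

definition L1 :: "complex \<Rightarrow> complex \<Rightarrow> operator" where
  "L1 q b f = (\<lambda>z. (b\<^sup>2 * z - q) / ((q - 1) * z) * T_plus q f z
                  + (q - b * z) / ((q - 1) * z) * f z)"

definition L2 :: "complex \<Rightarrow> complex \<Rightarrow> complex \<Rightarrow> operator" where
  "L2 q a b f = (\<lambda>z. (a * q - b\<^sup>2 * z) / (b * z) * T_minus q f z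
                    + (b ^ 3 * z - a * q) / (b * z) * f z)"

definition eigval :: "complex \<Rightarrow> nat \<Rightarrow> complex" where
  "eigval q n = q ^ n / (q - 1)"

definition linear_pencil :: "operator \<Rightarrow> operator \<Rightarrow> complex \<Rightarrow> operator" where
  "linear_pencil L M c f = (\<lambda>z. L f z - c * M f z)"

definition in_kernel :: "operator \<Rightarrow> (complex \<Rightarrow> complex) \<Rightarrow> bool" where
  "in_kernel L f \<longleftrightarrow> (\<forall>z. z \<noteq> 0 \<longrightarrow> L f z = 0)"

end

theory Submission
  imports Defs
begin

text \<open>
  Clearing denominators, \<open>b * (q - 1) * z * (L1 - \<lambda>\<^sub>n * L2)\<close> sends \<open>z ^ k\<close> to
  \<open>\<alpha>\<^sub>k * z ^ k - \<beta>\<^sub>k * z ^ (k + 1)\<close>, where \<open>\<alpha>\<^sub>k = q * (1 - q ^ k) * (b - a * q ^ (n - k))\<close> and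
  \<open>\<beta>\<^sub>k = b\<^sup>2 * (1 - b * q ^ k) * (1 - q ^ (n - k))\<close> (lemma \<open>pencil_on_polynomial\<close>). The pencil
  is thus bidiagonal on monomials, and it annihilates \<open>\<Sum>k\<le>n. c\<^sub>k * z ^ k\<close> as soon as
  \<open>\<alpha>\<^sub>k\<^sub>+\<^sub>1 * c\<^sub>k\<^sub>+\<^sub>1 = \<beta>\<^sub>k * c\<^sub>k\<close> for \<open>k < n\<close> (lemma \<open>pencil_annihilates_polynomial\<close>):
  the two remaining boundary terms are absent because \<open>\<alpha>\<^sub>0 = 0\<close> and \<open>\<beta>\<^sub>n = 0\<close>, the latter
  thanks to the value \<open>\<lambda>\<^sub>n = q ^ n / (q - 1)\<close>. The recurrence is precisely the ratio of
  successive coefficients of the basic hypergeometric series that defines the Pastro polynomials (lemma \<open>pastro_coeff_Suc\<close>).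

  Each of the two operators is of little q-Heun type because it has a single shift term and its
  two coefficients add up to a constant, which serves as \<open>p\<^sub>1\<close>.
\<close>

lemma q_pochhammer_Suc: "q_pochhammer y q (Suc k) = q_pochhammer y q k * (1 - y * q ^ k)"
  by (simp add: q_pochhammer_def)

text \<open>For \<open>k < n\<close> the negative powers of \<open>q\<close> in the series can be reflected,
  \<open>1 - x / y = - (x - y) / y\<close>, which turns the hypergeometric coefficient ratio into a
  relation between ordinary powers.\<close>

lemma pastro_coeff_Suc:
  assumes q: "q \<noteq> 0" "\<And>m::nat. m > 0 \<Longrightarrow> q ^ m \<noteq> 1" and a: "a \<noteq> 0"
    and ab: "\<And>k::nat. a * q ^ k \<noteq> b" and k: "k < n"
  shows "q * (1 - q ^ Suc k) * (b - a * q ^ (n - Suc k)) * pastro_coeff q a b n (Suc k) =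
         b\<^sup>2 * (1 - b * q ^ k) * (1 - q ^ (n - k)) * pastro_coeff q a b n k"
proof -
  define m where "m = n - Suc k"
  have n: "n = m + Suc k" using k by (simp add: m_def)
  have "q powi (- int n) = 1 / q ^ n"
    by (simp add: power_int_minus divide_inverse)
  also have "q ^ n = q ^ Suc m * q ^ k"
    by (simp add: n power_add)
  finally have "q powi (- int n) * q ^ k = 1 / q ^ Suc m"
    using q(1) by simp
  then have upper: "1 - q powi (- int n) * q ^ k = - (1 - q ^ Suc m) / q ^ Suc m"
    using q(1) by (simp add: field_simps)
  have "q powi (1 - int n) * q ^ k = q powi (- int m)"
    using q(1) by (simp add: n flip: power_int_add power_int_of_nat)
  then have "b / a * q powi (1 - int n) * q ^ k = b / (a * q ^ m)"
    by (simp add: power_int_minus divide_inverse mult.assoc)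
  then have lower: "1 - b / a * q powi (1 - int n) * q ^ k = - (b - a * q ^ m) / (a * q ^ m)"
    using q(1) a by (simp add: field_simps)
  have nz: "b - a * q ^ m \<noteq> 0" "1 - q ^ Suc k \<noteq> 0"
    using ab[of m] q(2)[of "Suc k"] by auto
  define A B C D where "A = q_pochhammer (q powi (- int n)) q k" and "B = q_pochhammer b q k"
    and "C = q_pochhammer (b / a * q powi (1 - int n)) q k" and "D = q_pochhammer q q k"
  have CD: "C \<noteq> 0" "D \<noteq> 0"
    using pastro_denominator_nonzero[OF q a ab, of k n] k by (auto simp: C_def D_def)
  have "pastro_coeff q a b n (Suc k) =
      (A * (- (1 - q ^ Suc m) / q ^ Suc m)) * (B * (1 - b * q ^ k)) /
      ((C * (- (b - a * q ^ m) / (a * q ^ m))) * (D * (1 - q ^ Suc k))) * (b\<^sup>2 / a) ^ Suc k"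
    unfolding pastro_coeff_def q_pochhammer_Suc upper lower A_def B_def C_def D_def by simp
  also have "\<dots> = (A * B / (C * D) * (b\<^sup>2 / a) ^ k) *
      (b\<^sup>2 * (1 - b * q ^ k) * (1 - q ^ Suc m) / (q * (b - a * q ^ m) * (1 - q ^ Suc k)))"
  proof -
    have ratio: "(A * (- x / (q * p))) * (B * y) / ((C * (- u / (a * p))) * (D * v)) * (e / a * r)
        = (A * B / (C * D) * r) * (e * y * x / (q * u * v))"
      if "p \<noteq> 0" "u \<noteq> 0" "v \<noteq> 0" for x y p u v e r
      using that q(1) a CD by (simp add: divide_simps)
    show ?thesis
      unfolding power_Suc[of q m] power_Suc[of "b\<^sup>2 / a" k]
      by (rule ratio) (use nz q(1) in auto)
  qed
  also have "A * B / (C * D) * (b\<^sup>2 / a) ^ k = pastro_coeff q a b n k"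
    by (simp add: pastro_coeff_def A_def B_def C_def D_def)
  finally have "pastro_coeff q a b n (Suc k) = pastro_coeff q a b n k *
      (b\<^sup>2 * (1 - b * q ^ k) * (1 - q ^ Suc m) / (q * (b - a * q ^ m) * (1 - q ^ Suc k)))" .
  moreover have "n - Suc k = m" "n - k = Suc m" by (simp_all add: n)
  moreover have "q * v * u * (t * (e / (q * u * v))) = e * t" if "u \<noteq> 0" "v \<noteq> 0" for t e u v
    using that q(1) by simp
  ultimately show ?thesis using nz by (simp only: not_False_eq_True)
qed

text \<open>On \<open>z ^ k\<close> the shift \<open>z \<mapsto> z / q\<close> produces \<open>q powi (- k)\<close>, which the eigenvalue factor \<open>q ^ n\<close>
  turns into \<open>q ^ (n - k)\<close>; this is why the result is free of negative powers for \<open>k \<le> n\<close>.\<close>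

lemma pencil_on_polynomial:
  fixes c :: "nat \<Rightarrow> complex" and a :: complex and n :: nat
  assumes q: "q \<noteq> 0" "q \<noteq> 1" and b: "b \<noteq> 0" and z: "z \<noteq> 0"
  defines "f \<equiv> \<lambda>z. \<Sum>k\<le>n. c k * z ^ k"
  shows "b * (q - 1) * z * linear_pencil (L1 q b) (L2 q a b) (eigval q n) f z =
    (\<Sum>k\<le>n. q * (1 - q ^ k) * (b - a * q ^ (n - k)) * c k * z ^ k) -
    (\<Sum>k\<le>n. b\<^sup>2 * (1 - b * q ^ k) * (1 - q ^ (n - k)) * c k * z ^ Suc k)"
proof -
  have clear: "b * (q - 1) * z * ((b\<^sup>2 * z - q) / ((q - 1) * z) * u + (q - b * z) / ((q - 1) * z) * w
        - p / (q - 1) * ((a * q - b\<^sup>2 * z) / (b * z) * v + (b ^ 3 * z - a * q) / (b * z) * w))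
      = b * (b\<^sup>2 * z - q) * u + b * (q - b * z) * w
        - p * ((a * q - b\<^sup>2 * z) * v + (b ^ 3 * z - a * q) * w)" for u v w p
  proof -
    have "q - 1 \<noteq> 0" using q(2) by simp
    then have 1: "b * (q - 1) * z * (s / ((q - 1) * z)) = b * s" for s
      using z by simp
    have 2: "b * (q - 1) * z * (p / (q - 1) * (s / (b * z))) = p * s" for s
      using z b \<open>q - 1 \<noteq> 0\<close> by simp
    show ?thesis
      using 1[of "(b\<^sup>2 * z - q) * u"] 1[of "(q - b * z) * w"]
        2[of "(a * q - b\<^sup>2 * z) * v"] 2[of "(b ^ 3 * z - a * q) * w"]
      by (simp add: ring_distribs)
  qed
  have "b * (q - 1) * z * linear_pencil (L1 q b) (L2 q a b) (eigval q n) f z =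
      b * (b\<^sup>2 * z - q) * f (q * z) + b * (q - b * z) * f z
        - q ^ n * ((a * q - b\<^sup>2 * z) * f (z / q) + (b ^ 3 * z - a * q) * f z)"
    unfolding linear_pencil_def L1_def L2_def T_plus_def T_minus_def eigval_def by (rule clear)
  also have "\<dots> = (\<Sum>k\<le>n. b * (b\<^sup>2 * z - q) * (c k * (q * z) ^ k) + b * (q - b * z) * (c k * z ^ k)
        - q ^ n * ((a * q - b\<^sup>2 * z) * (c k * (z / q) ^ k) + (b ^ 3 * z - a * q) * (c k * z ^ k)))"
    by (simp add: f_def sum_distrib_left flip: sum.distrib sum_subtractf)
  also have "\<dots> = (\<Sum>k\<le>n. q * (1 - q ^ k) * (b - a * q ^ (n - k)) * c k * z ^ k
        - b\<^sup>2 * (1 - b * q ^ k) * (1 - q ^ (n - k)) * c k * z ^ Suc k)"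
  proof (rule sum.cong)
    fix k assume "k \<in> {..n}"
    then have "q ^ n = q ^ (n - k) * q ^ k" by (simp flip: power_add)
    then have shift: "q ^ n * (z / q) ^ k = q ^ (n - k) * z ^ k"
      using q(1) by (simp add: power_divide)
    define N Q M Z Y where "N = q ^ n" and "Q = q ^ k" and "M = q ^ (n - k)" and "Z = z ^ k" and "Y = (z / q) ^ k"
    have N: "N = M * Q" "N * Y = M * Z"
      using \<open>q ^ n = _\<close> shift by (auto simp: N_def Q_def M_def Z_def Y_def)
    have "b * (b\<^sup>2 * z - q) * (d * (Q * Z)) + b * (q - b * z) * (d * Z)
        - N * ((a * q - b\<^sup>2 * z) * (d * Y) + (b ^ 3 * z - a * q) * (d * Z))
      = q * (1 - Q) * (b - a * M) * d * Z - b\<^sup>2 * (1 - b * Q) * (1 - M) * d * (z * Z)" for d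
      using N by algebra
    then show "b * (b\<^sup>2 * z - q) * (c k * (q * z) ^ k) + b * (q - b * z) * (c k * z ^ k)
        - q ^ n * ((a * q - b\<^sup>2 * z) * (c k * (z / q) ^ k) + (b ^ 3 * z - a * q) * (c k * z ^ k))
      = q * (1 - q ^ k) * (b - a * q ^ (n - k)) * c k * z ^ k
        - b\<^sup>2 * (1 - b * q ^ k) * (1 - q ^ (n - k)) * c k * z ^ Suc k"
      unfolding power_mult_distrib power_Suc
      unfolding N_def Q_def M_def Z_def Y_def .
  qed simp
  finally show ?thesis by (simp add: sum_subtractf)
qed

text \<open>The first sum of \<open>pencil_on_polynomial\<close> loses its term \<open>k = 0\<close> to the factor \<open>1 - q ^ k\<close>, the
  second its term \<open>k = n\<close> to \<open>1 - q ^ (n - k)\<close>; the recurrence then matches the rest up to an index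
  shift.\<close>

lemma pencil_annihilates_polynomial:
  fixes c :: "nat \<Rightarrow> complex"
  assumes "q \<noteq> 0" "q \<noteq> 1" "b \<noteq> 0" "z \<noteq> 0"
    and rec: "\<And>k. k < n \<Longrightarrow> q * (1 - q ^ Suc k) * (b - a * q ^ (n - Suc k)) * c (Suc k) =
                b\<^sup>2 * (1 - b * q ^ k) * (1 - q ^ (n - k)) * c k"
  shows "linear_pencil (L1 q b) (L2 q a b) (eigval q n) (\<lambda>z. \<Sum>k\<le>n. c k * z ^ k) z = 0"
proof -
  have "(\<Sum>k\<le>n. q * (1 - q ^ k) * (b - a * q ^ (n - k)) * c k * z ^ k) =
      (\<Sum>k<n. q * (1 - q ^ Suc k) * (b - a * q ^ (n - Suc k)) * c (Suc k) * z ^ Suc k)"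
    by (simp add: sum.atMost_shift)
  also have "\<dots> = (\<Sum>k<n. b\<^sup>2 * (1 - b * q ^ k) * (1 - q ^ (n - k)) * c k * z ^ Suc k)"
    by (rule sum.cong[OF refl]) (simp only: rec lessThan_iff)
  also have "\<dots> = (\<Sum>k\<le>n. b\<^sup>2 * (1 - b * q ^ k) * (1 - q ^ (n - k)) * c k * z ^ Suc k)"
    by (simp flip: lessThan_Suc_atMost)
  finally have "b * (q - 1) * z *
      linear_pencil (L1 q b) (L2 q a b) (eigval q n) (\<lambda>z. \<Sum>k\<le>n. c k * z ^ k) z = 0"
    using pencil_on_polynomial[where q = q and b = b and z = z and a = a and n = n and c = c] assms(1-4) by simp
  then show ?thesis using assms(2-4) by simp
qed

lemma little_q_Heun_L1:
  assumes "q \<noteq> 1"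
  shows "little_q_Heun q (L1 q b)"
proof -
  \<comment> \<open>\<open>p2 = - q * r2\<close> removes the backward shift.\<close>
  define r where "r = [:- q / (q - 1), b\<^sup>2 / (q - 1):]"
  have "degree r \<le> 2" "degree (smult (- q) r) \<le> 2" "degree [:(b\<^sup>2 - b) / (q - 1):] \<le> 1"
    by (simp_all add: r_def)
  moreover have "operator_eq (L1 q b) (q_difference_operator q (\<lambda>z. poly r z / z)
      (\<lambda>z. (q * poly r z + poly (smult (- q) r) z) / z)
      (\<lambda>z. - (poly r z / z) - (q * poly r z + poly (smult (- q) r) z) / z
           + poly [:(b\<^sup>2 - b) / (q - 1):] z))"
    unfolding operator_eq_def
  proof (intro allI impI)
    fix f and z :: complex assume z: "z \<noteq> 0"
    have "q - 1 \<noteq> 0" using assms by simp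
    then have A1: "poly r z / z = (b\<^sup>2 * z - q) / ((q - 1) * z)"
      and A0: "- (poly r z / z) + (b\<^sup>2 - b) / (q - 1) = (q - b * z) / ((q - 1) * z)"
      using z by (simp_all add: r_def divide_simps) (simp_all add: algebra_simps)
    show "L1 q b f z = q_difference_operator q (\<lambda>z. poly r z / z)
      (\<lambda>z. (q * poly r z + poly (smult (- q) r) z) / z)
      (\<lambda>z. - (poly r z / z) - (q * poly r z + poly (smult (- q) r) z) / z
           + poly [:(b\<^sup>2 - b) / (q - 1):] z) f z"
      unfolding L1_def q_difference_operator_def A1[symmetric] A0[symmetric] by simp
  qed
  ultimately show ?thesis unfolding little_q_Heun_def Let_def by blast
qed

lemma little_q_Heun_L2:
  assumes "b \<noteq> 0"
  shows "little_q_Heun q (L2 q a b)"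
proof -
  define p where "p = [:a * q / b, - b:]"
  have "degree (0 :: complex poly) \<le> 2" "degree p \<le> 2" "degree [:b\<^sup>2 - b:] \<le> 1"
    by (simp_all add: p_def)
  moreover have "operator_eq (L2 q a b) (q_difference_operator q (\<lambda>z. poly 0 z / z)
      (\<lambda>z. (q * poly 0 z + poly p z) / z)
      (\<lambda>z. - (poly 0 z / z) - (q * poly 0 z + poly p z) / z + poly [:b\<^sup>2 - b:] z))"
    unfolding operator_eq_def
  proof (intro allI impI)
    fix f and z :: complex assume z: "z \<noteq> 0"
    have A2: "poly p z / z = (a * q - b\<^sup>2 * z) / (b * z)"
      and A0: "- (poly p z / z) + (b\<^sup>2 - b) = (b ^ 3 * z - a * q) / (b * z)"
      using z assms
      by (simp_all add: p_def divide_simps)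
         (simp_all add: algebra_simps power2_eq_square power3_eq_cube)
    show "L2 q a b f z = q_difference_operator q (\<lambda>z. poly 0 z / z)
      (\<lambda>z. (q * poly 0 z + poly p z) / z)
      (\<lambda>z. - (poly 0 z / z) - (q * poly 0 z + poly p z) / z + poly [:b\<^sup>2 - b:] z) f z"
      unfolding L2_def q_difference_operator_def A2[symmetric] A0[symmetric] by simp
  qed
  ultimately show ?thesis unfolding little_q_Heun_def Let_def by blast
qed

theorem mainTheorem7:
  fixes q a b :: complex
  assumes "q \<noteq> 0"
    and "\<And>m::nat. m > 0 \<Longrightarrow> q ^ m \<noteq> 1"
    and "a \<noteq> 0" and "b \<noteq> 0"
    and "\<And>k::nat. b * q ^ k \<noteq> 1"
    and "\<And>k::nat. a * q ^ k \<noteq> b"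
  shows "little_q_Heun q (L1 q b) \<and> little_q_Heun q (L2 q a b) \<and>
    (\<forall>n. (\<forall>z. z \<noteq> 0 \<longrightarrow>
             L1 q b (poly (pastro q a b n)) z = eigval q n * L2 q a b (poly (pastro q a b n)) z) \<and>
         in_kernel (linear_pencil (L1 q b) (L2 q a b) (eigval q n)) (poly (pastro q a b n)))"
proof -
  have q1: "q \<noteq> 1" using assms(2)[of 1] by simp
  have ker: "linear_pencil (L1 q b) (L2 q a b) (eigval q n) (poly (pastro q a b n)) z = 0"
    if "z \<noteq> 0" for n z
  proof -
    define c where "c k = pastro_kappa q a b n * pastro_coeff q a b n k" for k
    have "poly (pastro q a b n) = (\<lambda>z. \<Sum>k\<le>n. c k * z ^ k)"
      by (simp add: fun_eq_iff pastro_def pastro_2phi1_def poly_sum poly_monom c_def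
          sum_distrib_left mult.assoc)
    moreover have "q * (1 - q ^ Suc k) * (b - a * q ^ (n - Suc k)) * c (Suc k) =
        b\<^sup>2 * (1 - b * q ^ k) * (1 - q ^ (n - k)) * c k" if "k < n" for k
    proof -
      have "q * (1 - q ^ Suc k) * (b - a * q ^ (n - Suc k)) * pastro_coeff q a b n (Suc k) =
          b\<^sup>2 * (1 - b * q ^ k) * (1 - q ^ (n - k)) * pastro_coeff q a b n k"
        by (rule pastro_coeff_Suc) (use assms that in auto)
      then show ?thesis by (simp only: c_def mult.left_commute)
    qed
    ultimately show ?thesis
      using pencil_annihilates_polynomial[where q = q and b = b and z = z and a = a and n = n and c = c] assms(1,4) q1 \<open>z \<noteq> 0\<close> by simp
  qed
  then have "L1 q b (poly (pastro q a b n)) z = eigval q n * L2 q a b (poly (pastro q a b n)) z"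
    if "z \<noteq> 0" for n z
    using that by (simp add: linear_pencil_def)
  with ker show ?thesis
    using little_q_Heun_L1[OF q1] little_q_Heun_L2[OF assms(4)] by (simp add: in_kernel_def)
qed

end
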